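(* The Median-point Mechanism (Med-M) is strategyproof when both locations and group memberships are private, and has an approximation ratio of $2$ for minimizing the social cost; that is, for every profile $\mathbf r$, the output $y$ of Med-M satisfies $\mathrm{SC}(y,\mathbf r)\le 2\min_{z\in[0,1]}\mathrm{SC}(z,\mathbf r)$.
   Context: Setting. $N=\{1,\dots,n\}$ is a set of agents, $I=[0,1]$, $[m]=\{1,\dots,m\}$ indexes groups. Agent $i$ has a profile $r_i=(x_i,g_i)$ with location $x_i\in I$ and group $g_i\in[m]$; $\mathbf r=(r_1,\dots,r_n)$. $G_j=\{i\in N: g_i=j\}$. $d(a,b)=|a-b|$. Each group $j$ has a known externality factor $\alpha_j\ge 0$. If the facility is at $y\in I$, the cost of agent $i$ is $$c_i(y,\mathbf r)=d(y,x_i)+\alpha_{g_i}\sum_{k\in G_{g_i}\setminus\{i\}}(1-d(y,x_k)).$$ Standing assumption on (true) profiles: $\alpha_j\le 1/(|G_j|-1)$ for each group $j$ (void if $|G_j|\le 1$). Social cost: $\mathrm{SC}(y,\mathbf r)=\sum_{i\in N}c_i(y,\mathbf r)$. A (deterministic) mechanism $f$ maps a profile to a facility location in $I$. Strategyproof when both locations and group memberships are private: for every true profile $\mathbf r$, every reported profile $\mathbf r'$ and every agent $i$, $c_i(f(r_i,\mathbf r'_{-i}),\mathbf r)\le c_i(f(\mathbf r'),\mathbf r)$, where $\mathbf r'_{-i}$ are the reports of all agents other than $i$. Med-M: relabel agents so that $x_1\le\dots\le x_n$ (reported locations) and output $y=x_{\lceil n/2\rceil}$. *)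

theory Defs
  imports Complex_Main "HOL-Library.FuncSet"
begin

(* An agent's report: her location together with (the index of) her group. *)
type_synonym report = "real \<times> nat"
type_synonym profile = "nat \<Rightarrow> report"

definition profiles :: "nat \<Rightarrow> nat \<Rightarrow> profile set" where
  "profiles n m = {1..n} \<rightarrow>\<^sub>E {0..1} \<times> {1..m}"

abbreviation location :: "profile \<Rightarrow> nat \<Rightarrow> real" where
  "location r i \<equiv> fst (r i)"

abbreviation group_of :: "profile \<Rightarrow> nat \<Rightarrow> nat" where
  "group_of r i \<equiv> snd (r i)"

definition members :: "nat \<Rightarrow> profile \<Rightarrow> nat \<Rightarrow> nat set" where
  "members n r j = {i \<in> {1..n}. group_of r i = j}"

(* The bound is void for groups with at most one member; the guard is needed because
   1 / 0 = 0 in HOL. *)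
definition externality_bound :: "nat \<Rightarrow> nat \<Rightarrow> (nat \<Rightarrow> real) \<Rightarrow> profile \<Rightarrow> bool" where
  "externality_bound n m \<alpha> r \<longleftrightarrow>
     (\<forall>j\<in>{1..m}. card (members n r j) > 1 \<longrightarrow> \<alpha> j \<le> 1 / (real (card (members n r j)) - 1))"

definition true_profiles :: "nat \<Rightarrow> nat \<Rightarrow> (nat \<Rightarrow> real) \<Rightarrow> profile set" where
  "true_profiles n m \<alpha> = {r \<in> profiles n m. externality_bound n m \<alpha> r}"

definition agent_cost :: "nat \<Rightarrow> (nat \<Rightarrow> real) \<Rightarrow> profile \<Rightarrow> nat \<Rightarrow> real \<Rightarrow> real" where
  "agent_cost n \<alpha> r i y =
     dist y (location r i) +
     \<alpha> (group_of r i) * (\<Sum>k\<in>members n r (group_of r i) - {i}. 1 - dist y (location r k))"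

definition social_cost :: "nat \<Rightarrow> (nat \<Rightarrow> real) \<Rightarrow> profile \<Rightarrow> real \<Rightarrow> real" where
  "social_cost n \<alpha> r y = (\<Sum>i\<in>{1..n}. agent_cost n \<alpha> r i y)"

definition is_mechanism :: "nat \<Rightarrow> nat \<Rightarrow> (profile \<Rightarrow> real) \<Rightarrow> bool" where
  "is_mechanism n m f \<longleftrightarrow> f \<in> profiles n m \<rightarrow> {0..1}"

(* r is the true profile and r' the reported one. Only r is subject to the externality bound,
   and all costs are evaluated with respect to r; since r and r' may differ in both components,
   locations as well as group memberships are private. *)
definition strategyproof :: "nat \<Rightarrow> nat \<Rightarrow> (nat \<Rightarrow> real) \<Rightarrow> (profile \<Rightarrow> real) \<Rightarrow> bool" where
  "strategyproof n m \<alpha> f \<longleftrightarrow>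
     (\<forall>r\<in>true_profiles n m \<alpha>. \<forall>r'\<in>profiles n m. \<forall>i\<in>{1..n}.
        agent_cost n \<alpha> r i (f (r'(i := r i))) \<le> agent_cost n \<alpha> r i (f r'))"

(* The minimum over [0,1] is represented by a minimizer z, whose existence is part of the claim. *)
definition approximates_social_cost ::
    "nat \<Rightarrow> nat \<Rightarrow> (nat \<Rightarrow> real) \<Rightarrow> real \<Rightarrow> (profile \<Rightarrow> real) \<Rightarrow> bool" where
  "approximates_social_cost n m \<alpha> \<rho> f \<longleftrightarrow>
     (\<forall>r\<in>true_profiles n m \<alpha>.
        \<exists>z. is_arg_min (social_cost n \<alpha> r) (\<lambda>w. w \<in> {0..1}) z \<and>
            social_cost n \<alpha> r (f r) \<le> \<rho> * social_cost n \<alpha> r z)"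

(* List positions start at 0, so x_k in the sorted order is the entry at position k - 1. *)
definition median_mechanism :: "nat \<Rightarrow> profile \<Rightarrow> real" where
  "median_mechanism n r = sort (map (location r) [1..<Suc n]) ! (nat \<lceil>real n / 2\<rceil> - 1)"

end

theory Submission
  imports Defs
begin

text \<open>
  Strategyproofness: if \<open>i\<close> reports truthfully, the median moves weakly towards \<open>x\<^sub>i\<close>. When the
  facility moves a distance \<open>t\<close> away from \<open>x\<^sub>i\<close>, the distance part of the cost of \<open>i\<close> grows by \<open>t\<close>,
  while the externality part drops by at most \<open>\<alpha>\<^sub>j (card G\<^sub>j - 1) t \<le> t\<close>.

  Approximation: exchanging the two summations shows that the social cost at \<open>w\<close> is the sum of
  \<open>\<beta>\<^sub>i + (1 - \<beta>\<^sub>i) d(w, x\<^sub>i)\<close>, where \<open>\<beta>\<^sub>i = \<alpha>\<^sub>j (card G\<^sub>j - 1)\<close>, \<open>j = g\<^sub>i\<close>, lies in \<open>[0, 1]\<close>.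
  Let \<open>y\<close> be the median, \<open>z\<close> any other point and \<open>\<delta> = d(y, z) \<le> 1\<close>. At least half of the agents
  lie on the side of \<open>y\<close> opposite to \<open>z\<close>; for them twice the summand at \<open>z\<close> exceeds the summand
  at \<open>y\<close> by at least \<open>\<delta>\<close>. For every other agent it falls short by at most \<open>\<delta>\<close>.
\<close>

section \<open>The median\<close>

text \<open>An antimonotone predicate holds exactly on a prefix of a sorted list, and filtering
  keeps just that prefix.\<close>

lemma sorted_nth_iff_filter:
  fixes ys :: "'a::linorder list"
  assumes "antimono P" "sorted ys" "k < length ys"
  shows "P (ys ! k) \<longleftrightarrow> k < length (filter P ys)"
  using assms(2,3)
proof (induction ys arbitrary: k)
  case (Cons a ys)
  show ?case
  proof (cases "P a")
    case True
    then show ?thesis using Cons by (cases k) auto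
  next
    case False
    have none: "\<not> P x" if "x \<in> set (a # ys)" for x
      using that False Cons.prems antimonoD[OF assms(1), of a x] by auto
    then have "filter P (a # ys) = []"
      by (auto simp: filter_empty_conv)
    then show ?thesis using none[OF nth_mem[OF Cons.prems(2)]] by simp
  qed
qed simp

lemma nat_ceiling_half: "nat \<lceil>real n / 2\<rceil> = (n + 1) div 2"
proof -
  have "\<lceil>real n / 2\<rceil> = int ((n + 1) div 2)"
    by (rule ceiling_unique) linarith+
  then show ?thesis by simp
qed

text \<open>Replaces sorting by counting: sorting does not change how many entries satisfy
  \<open>P\<close>. All later comparisons with the median use \<open>P\<close> of the form
  \<open>x \<le> c\<close> or \<open>x < c\<close>.\<close>

lemma median_iff_card:
  assumes "n \<ge> 1" "antimono P"
  shows "P (median_mechanism n r) \<longleftrightarrow> (n + 1) div 2 \<le> card {i \<in> {1..n}. P (location r i)}"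
proof -
  let ?xs = "map (location r) [1..<Suc n]"
  have "length (filter P (sort ?xs)) = length (filter P ?xs)"
    by (simp only: filter_sort length_sort)
  also have "\<dots> = length (filter (\<lambda>i. P (location r i)) [1..<Suc n])"
    by (simp add: filter_map o_def del: upt_Suc)
  also have "\<dots> = card {i \<in> {1..n}. P (location r i)}"
    by (subst distinct_card[symmetric]) (auto intro!: arg_cong[where f = card] simp del: upt_Suc)
  finally have len: "length (filter P (sort ?xs)) = card {i \<in> {1..n}. P (location r i)}" .
  have "P (median_mechanism n r) \<longleftrightarrow> (n + 1) div 2 - 1 < length (filter P (sort ?xs))"
    unfolding median_mechanism_def nat_ceiling_half
    using assms by (intro sorted_nth_iff_filter) (auto simp del: upt_Suc)
  \<comment> \<open>As \<open>n \<ge> 1\<close>, the number \<open>(n + 1) div 2\<close> is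
    positive, so the strict bound on the position counted from 0 becomes
    \<open>\<le>\<close>.\<close>
  then show ?thesis using len assms(1) by auto
qed

lemma antimono_le: "antimono (\<lambda>x::'a::order. x \<le> c)"
  by (auto simp: monotone_def)

lemma antimono_less: "antimono (\<lambda>x::'a::order. x < c)"
  by (auto simp: monotone_def)

lemma median_mem_locations:
  assumes "n \<ge> 1"
  shows "median_mechanism n r \<in> location r ` {1..n}"
proof -
  let ?xs = "sort (map (location r) [1..<Suc n])"
  have "median_mechanism n r \<in> set ?xs"
    unfolding median_mechanism_def nat_ceiling_half
    using assms by (intro nth_mem) (auto simp del: upt_Suc)
  then show ?thesis by (auto simp del: upt_Suc)
qed

lemma card_below_median:
  assumes "n \<ge> 1"
  shows "n \<le> 2 * card {i \<in> {1..n}. location r i \<le> median_mechanism n r}"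
  using median_iff_card[OF assms antimono_le, of r "median_mechanism n r"] by simp

lemma card_above_median:
  assumes "n \<ge> 1"
  shows "n \<le> 2 * card {i \<in> {1..n}. median_mechanism n r \<le> location r i}"
proof -
  \<comment> \<open>Lying above the median is not antimonotone, so the complement is counted; the
    median is not below itself, which forces \<open>card ?B < (n + 1) div 2\<close>.\<close>
  let ?B = "{i \<in> {1..n}. location r i < median_mechanism n r}"
  have "card {i \<in> {1..n}. median_mechanism n r \<le> location r i} = card ({1..n} - ?B)"
    by (intro arg_cong[where f = card]) auto
  also have "\<dots> = n - card ?B"
    by (subst card_Diff_subset) auto
  finally show ?thesis
    using median_iff_card[OF assms antimono_less, of r "median_mechanism n r"] by simp
qed

text \<open>Replacing one location by \<open>fst p\<close> cannot lower the count for
  \<open>P\<close> if \<open>P (fst p)\<close> holds, and cannot raise it otherwise. So a median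
  that agrees with \<open>fst p\<close> about \<open>P\<close> keeps agreeing.\<close>

lemma median_update:
  fixes P :: "real \<Rightarrow> bool"
  assumes "n \<ge> 1" "antimono P" "P (median_mechanism n r) = P (fst p)"
  shows "P (median_mechanism n (r(i := p))) = P (fst p)"
proof (cases "P (fst p)")
  case True
  then have "card {j \<in> {1..n}. P (location r j)} \<le> card {j \<in> {1..n}. P (location (r(i := p)) j)}"
    by (intro card_mono) auto
  then show ?thesis using True assms by (simp add: median_iff_card)
next
  case False
  then have "card {j \<in> {1..n}. P (location (r(i := p)) j)} \<le> card {j \<in> {1..n}. P (location r j)}"
    by (intro card_mono) (auto split: if_splits)
  then show ?thesis using False assms by (simp add: median_iff_card)
qed

text \<open>The new median lies between the old one and \<open>fst p\<close>; equality in the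
  triangle inequality expresses this without distinguishing sides.\<close>

lemma dist_median_update:
  assumes "n \<ge> 1"
  shows "dist (median_mechanism n r) (fst p) =
    dist (median_mechanism n r) (median_mechanism n (r(i := p))) +
    dist (median_mechanism n (r(i := p))) (fst p)"
proof -
  let ?y = "median_mechanism n r" and ?y' = "median_mechanism n (r(i := p))"
  have "?y' \<le> max ?y (fst p)"
    using median_update[OF assms antimono_le[of "max ?y (fst p)"], of r p i] by simp
  \<comment> \<open>Neither \<open>?y\<close> nor \<open>fst p\<close> is below their minimum, so
    the two agree on a false predicate.\<close>
  moreover have "\<not> ?y' < min ?y (fst p)"
    by (subst median_update[OF assms antimono_less]) auto
  ultimately show ?thesis by (auto simp: dist_real_def)
qed

section \<open>Costs under the externality bound\<close>

text \<open>This is \<beta> of the overview. It bounds how fast the externality part of the cost of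
  \<open>i\<close> changes with the facility, and it is also the total factor of
  \<open>1 - dist y (location r i)\<close> in the social cost.\<close>

definition externality_weight :: "nat \<Rightarrow> (nat \<Rightarrow> real) \<Rightarrow> profile \<Rightarrow> nat \<Rightarrow> real" where
  "externality_weight n \<alpha> r i =
     \<alpha> (group_of r i) * (real (card (members n r (group_of r i))) - 1)"

lemma finite_members [simp]: "finite (members n r j)"
  by (simp add: members_def)

lemma members_self: "i \<in> {1..n} \<Longrightarrow> i \<in> members n r (group_of r i)"
  by (simp add: members_def)

lemma card_members_pos: "i \<in> {1..n} \<Longrightarrow> card (members n r (group_of r i)) \<ge> 1"
  using members_self[of i n r] by (metis One_nat_def Suc_leI card_gt_0_iff emptyE finite_members)

lemma profileD:
  assumes "r \<in> profiles n m" "i \<in> {1..n}"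
  shows "location r i \<in> {0..1}" "group_of r i \<in> {1..m}"
  using PiE_mem[OF assms[unfolded profiles_def]] by (auto simp: mem_Times_iff)

lemma externality_weight_bounds:
  assumes "r \<in> true_profiles n m \<alpha>" "i \<in> {1..n}" "\<forall>j\<in>{1..m}. \<alpha> j \<ge> 0"
  shows "0 \<le> externality_weight n \<alpha> r i" "externality_weight n \<alpha> r i \<le> 1"
proof -
  let ?c = "card (members n r (group_of r i))"
  have r: "r \<in> profiles n m" and eb: "externality_bound n m \<alpha> r"
    using assms(1) by (auto simp: true_profiles_def)
  note g = profileD(2)[OF r assms(2)]
  note c = card_members_pos[OF assms(2), of r]
  show "0 \<le> externality_weight n \<alpha> r i"
    using assms(3) g c by (auto simp: externality_weight_def intro!: mult_nonneg_nonneg)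
  show "externality_weight n \<alpha> r i \<le> 1"
  proof (cases "?c > 1")
    case True
    then have "\<alpha> (group_of r i) \<le> 1 / (real ?c - 1)"
      using eb g by (auto simp: externality_bound_def)
    then show ?thesis using True by (simp add: externality_weight_def field_simps)
  next
    case False
    then have "?c = 1" using c by simp
    then show ?thesis by (simp add: externality_weight_def)
  qed
qed

lemma agent_cost_mono:
  assumes "r \<in> true_profiles n m \<alpha>" "i \<in> {1..n}" "\<forall>j\<in>{1..m}. \<alpha> j \<ge> 0"
    and between: "dist y' (location r i) = dist y' y + dist y (location r i)"
  shows "agent_cost n \<alpha> r i y \<le> agent_cost n \<alpha> r i y'"
proof -
  let ?g = "group_of r i"
  let ?G = "members n r ?g - {i}"
  have r: "r \<in> profiles n m"
    using assms(1) by (auto simp: true_profiles_def)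
  have "0 \<le> \<alpha> ?g" using assms(3) profileD(2)[OF r assms(2)] by auto
  have card: "real (card ?G) = real (card (members n r ?g)) - 1"
    using members_self[OF assms(2), of r] card_members_pos[OF assms(2), of r]
    by (simp add: card_Diff_singleton of_nat_diff)
  have "(\<Sum>k\<in>?G. 1 - dist y (location r k)) \<le> (\<Sum>k\<in>?G. (1 - dist y' (location r k)) + dist y' y)"
    by (intro sum_mono) (simp add: algebra_simps dist_triangle)
  also have "\<dots> = (\<Sum>k\<in>?G. 1 - dist y' (location r k)) + real (card ?G) * dist y' y"
    by (simp add: sum.distrib)
  finally have "\<alpha> ?g * (\<Sum>k\<in>?G. 1 - dist y (location r k))
      \<le> \<alpha> ?g * ((\<Sum>k\<in>?G. 1 - dist y' (location r k)) + real (card ?G) * dist y' y)"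
    using \<open>0 \<le> \<alpha> ?g\<close> by (rule mult_left_mono)
  also have "\<dots> = \<alpha> ?g * (\<Sum>k\<in>?G. 1 - dist y' (location r k))
      + externality_weight n \<alpha> r i * dist y' y"
    by (simp add: card externality_weight_def algebra_simps)
  also have "\<dots> \<le> \<alpha> ?g * (\<Sum>k\<in>?G. 1 - dist y' (location r k)) + dist y' y"
    using externality_weight_bounds(2)[OF assms(1-3)] mult_right_mono[of _ 1 "dist y' y"] by simp
  finally show ?thesis using between by (simp add: agent_cost_def)
qed

lemma social_cost_eq:
  "social_cost n \<alpha> r y = (\<Sum>i\<in>{1..n}. externality_weight n \<alpha> r i
     + (1 - externality_weight n \<alpha> r i) * dist y (location r i))"
proof -
  let ?d = "\<lambda>k. 1 - dist y (location r k)"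
  have "(\<Sum>i\<in>{1..n}. \<alpha> (group_of r i) * (\<Sum>k\<in>members n r (group_of r i) - {i}. ?d k))
      = (\<Sum>i\<in>{1..n}. \<Sum>k | k \<in> {1..n} \<and> group_of r k = group_of r i \<and> k \<noteq> i.
          \<alpha> (group_of r i) * ?d k)"
    unfolding sum_distrib_left members_def by (intro sum.cong refl) auto
  \<comment> \<open>Being distinct members of one group is symmetric and \<alpha> is constant on a
    group, so each \<open>k\<close> collects its own term once per other member.\<close>
  also have "\<dots> = (\<Sum>k\<in>{1..n}. \<Sum>i | i \<in> {1..n} \<and> group_of r k = group_of r i \<and> k \<noteq> i.
          \<alpha> (group_of r i) * ?d k)"
    by (rule sum.swap_restrict) auto
  also have "\<dots> = (\<Sum>k\<in>{1..n}. \<Sum>i\<in>members n r (group_of r k) - {k}. \<alpha> (group_of r k) * ?d k)"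
    by (intro sum.cong refl) (auto simp: members_def)
  also have "\<dots> = (\<Sum>k\<in>{1..n}. externality_weight n \<alpha> r k * ?d k)"
  proof (intro sum.cong refl)
    fix k assume "k \<in> {1..n}"
    then have "real (card (members n r (group_of r k) - {k}))
        = real (card (members n r (group_of r k))) - 1"
      using members_self[of k n r] card_members_pos[of k n r]
      by (simp add: card_Diff_singleton of_nat_diff)
    then show "(\<Sum>i\<in>members n r (group_of r k) - {k}. \<alpha> (group_of r k) * ?d k)
        = externality_weight n \<alpha> r k * ?d k"
      by (simp add: externality_weight_def)
  qed
  finally show ?thesis
    by (simp add: social_cost_def agent_cost_def sum.distrib sum_subtractf algebra_simps)
qed

text \<open>\<open>S\<close> stands for the agents on the side of \<open>y\<close> opposite to
  \<open>z\<close>. Keeping it abstract covers \<open>z\<close> on either side of the median at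
  once.\<close>

lemma social_cost_le_twice:
  assumes "r \<in> true_profiles n m \<alpha>" "\<forall>j\<in>{1..m}. \<alpha> j \<ge> 0"
    and "S \<subseteq> {1..n}" "n \<le> 2 * card S" "dist y z \<le> 1"
    and far: "\<And>i. i \<in> S \<Longrightarrow> dist z (location r i) = dist y z + dist y (location r i)"
  shows "social_cost n \<alpha> r y \<le> 2 * social_cost n \<alpha> r z"
proof -
  define b where "b = externality_weight n \<alpha> r"
  define T where "T w i = b i + (1 - b i) * dist w (location r i)" for w i
  have b: "0 \<le> b i" "b i \<le> 1" if "i \<in> {1..n}" for i
    using externality_weight_bounds[OF assms(1) that assms(2)] by (auto simp: b_def)
  have gain: "T y i + dist y z \<le> 2 * T z i" if "i \<in> S" for i
  proof -
    have bi: "0 \<le> b i" "b i \<le> 1" using b that assms(3) by auto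
    \<comment> \<open>By \<open>far\<close>, the right-hand side equals
      \<open>2 * T z i - T y i - dist y z\<close>. Its first term is where
      \<open>dist y z \<le> 1\<close> enters.\<close>
    have "0 \<le> b i * (1 - dist y z) + (1 - b i) * (dist y z + dist y (location r i))"
      using bi assms(5) by (intro add_nonneg_nonneg mult_nonneg_nonneg) auto
    then show ?thesis by (simp add: T_def far[OF that] algebra_simps)
  qed
  have loss: "T y i - dist y z \<le> 2 * T z i" if "i \<in> {1..n}" for i
  proof -
    have "(1 - b i) * dist y (location r i) \<le> (1 - b i) * (dist y z + dist z (location r i))"
      using b[OF that] by (intro mult_left_mono dist_triangle) auto
    moreover have "0 \<le> b i * dist y z" "0 \<le> b i" "0 \<le> (1 - b i) * dist z (location r i)"
      using b[OF that] by auto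
    ultimately show ?thesis unfolding T_def ring_distribs by linarith
  qed
  have "(\<Sum>i\<in>{1..n}. T y i + (if i \<in> S then dist y z else - dist y z)) \<le> (\<Sum>i\<in>{1..n}. 2 * T z i)"
    by (intro sum_mono) (use gain loss in force)
  moreover have "(\<Sum>i\<in>{1..n}. if i \<in> S then dist y z else - dist y z)
      = (2 * real (card S) - real n) * dist y z"
  proof -
    \<comment> \<open>Writing the signed term as twice an indicator minus a constant avoids a sum
      over the complement of \<open>S\<close>.\<close>
    have "(\<Sum>i\<in>{1..n}. if i \<in> S then dist y z else - dist y z)
        = (\<Sum>i\<in>{1..n}. 2 * (if i \<in> S then dist y z else 0) - dist y z)"
      by (intro sum.cong) auto
    also have "\<dots> = 2 * (\<Sum>i\<in>{1..n}. if i \<in> S then dist y z else 0) - real n * dist y z"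
      by (simp add: sum_subtractf sum_distrib_left)
    also have "(\<Sum>i\<in>{1..n}. if i \<in> S then dist y z else 0) = real (card S) * dist y z"
      using assms(3) by (simp add: sum.inter_restrict[symmetric] Int_absorb1)
    finally show ?thesis by (simp add: algebra_simps)
  qed
  moreover have "0 \<le> (2 * real (card S) - real n) * dist y z"
    using assms(4) by (intro mult_nonneg_nonneg) auto
  ultimately have "(\<Sum>i\<in>{1..n}. T y i) \<le> 2 * (\<Sum>i\<in>{1..n}. T z i)"
    by (simp add: sum.distrib sum_distrib_left)
  then show ?thesis by (simp add: social_cost_eq T_def b_def)
qed

lemma median_social_cost_le:
  assumes "n \<ge> 1" "r \<in> true_profiles n m \<alpha>" "\<forall>j\<in>{1..m}. \<alpha> j \<ge> 0"
    and "dist (median_mechanism n r) z \<le> 1"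
  shows "social_cost n \<alpha> r (median_mechanism n r) \<le> 2 * social_cost n \<alpha> r z"
proof (cases "median_mechanism n r \<le> z")
  case True
  show ?thesis
    by (rule social_cost_le_twice[OF assms(2,3) _ card_below_median[OF assms(1), of r] assms(4)])
      (use True in \<open>auto simp: dist_real_def\<close>)
next
  case False
  show ?thesis
    by (rule social_cost_le_twice[OF assms(2,3) _ card_above_median[OF assms(1), of r] assms(4)])
      (use False in \<open>auto simp: dist_real_def\<close>)
qed

lemma social_cost_attains_min:
  "\<exists>z. is_arg_min (social_cost n \<alpha> r) (\<lambda>w. w \<in> {0..1}) z"
proof -
  have "continuous_on {0..1} (social_cost n \<alpha> r)"
    unfolding social_cost_def agent_cost_def by (intro continuous_intros)
  then obtain z where "z \<in> {0..1}" "\<forall>w\<in>{0..1}. social_cost n \<alpha> r z \<le> social_cost n \<alpha> r w"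
    using continuous_attains_inf[of "{0..1::real}" "social_cost n \<alpha> r"] by auto
  then show ?thesis by (auto simp: is_arg_min_linorder)
qed

lemma median_mechanism_unit:
  assumes "n \<ge> 1" "r \<in> profiles n m"
  shows "median_mechanism n r \<in> {0..1}"
proof -
  obtain i where "i \<in> {1..n}" "median_mechanism n r = location r i"
    using median_mem_locations[OF assms(1)] by blast
  then show ?thesis using profileD(1)[OF assms(2)] by simp
qed

theorem theorem1:
  fixes n m :: nat and \<alpha> :: "nat \<Rightarrow> real"
  assumes "n \<ge> 1"
    and "\<forall>j\<in>{1..m}. \<alpha> j \<ge> 0"
  shows "is_mechanism n m (median_mechanism n) \<and>
         strategyproof n m \<alpha> (median_mechanism n) \<and>
         approximates_social_cost n m \<alpha> 2 (median_mechanism n)"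
proof (intro conjI)
  show "is_mechanism n m (median_mechanism n)"
    using median_mechanism_unit[OF assms(1)] by (auto simp: is_mechanism_def)
  show "strategyproof n m \<alpha> (median_mechanism n)"
    unfolding strategyproof_def
    \<comment> \<open>Betweenness is taken for the reported profile, with the true report
      \<open>r i\<close> as \<open>p\<close>; the costs refer to the true profile.\<close>
    by (intro ballI agent_cost_mono[OF _ _ assms(2)] dist_median_update[OF assms(1)])
  show "approximates_social_cost n m \<alpha> 2 (median_mechanism n)"
    unfolding approximates_social_cost_def
  proof
    fix r assume r: "r \<in> true_profiles n m \<alpha>"
    obtain z where z: "is_arg_min (social_cost n \<alpha> r) (\<lambda>w. w \<in> {0..1}) z"
      using social_cost_attains_min by blast
    have "median_mechanism n r \<in> {0..1}"
      using r median_mechanism_unit[OF assms(1)] by (auto simp: true_profiles_def)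
    moreover have "z \<in> {0..1}"
      using z by (simp add: is_arg_min_def)
    ultimately have "dist (median_mechanism n r) z \<le> 1"
      by (auto simp: dist_real_def)
    from median_social_cost_le[OF assms(1) r assms(2) this] z
    show "\<exists>z. is_arg_min (social_cost n \<alpha> r) (\<lambda>w. w \<in> {0..1}) z \<and>
        social_cost n \<alpha> r (median_mechanism n r) \<le> 2 * social_cost n \<alpha> r z"
      by blast
  qed
qed

end
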